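(* Let $X$ be an order complete locally solid $\ell$-ring with unity. Then the following are equivalent. (i) $X$ possesses the $AM$-property and the Levi property. (ii) Every order bounded subset of $X$ is bounded, and every bounded subset of $X$ is order bounded.
   Context: An $\ell$-ring (lattice ring) is a ring which is also a lattice, the additive group being a lattice-ordered group, with $|x\cdot y|\le |x|\cdot|y|$ for all $x,y$. $X_+=\{x\in X: x\ge 0\}$. A set $S\subseteq X$ is solid if $x\in X$, $y\in S$, $|x|\le|y|$ imply $x\in S$. A locally solid $\ell$-ring is an $\ell$-ring that is also a topological ring and has a local basis at zero consisting of solid sets. Order complete: every non-empty subset that is bounded above has a supremum. Archimedean: $nx\le y$ for all $n\in\mathbb N$ implies $x\le 0$. A set $B\subseteq X$ in a topological ring is bounded if for each zero neighborhood $W$ there is a zero neighborhood $V$ with $VB\subseteq W$ and $BV\subseteq W$ (sets of products). A set is order bounded if it is contained in some order interval $[u,v]=\{x: u\le x\le v\}$. For $B\subseteq X$, $B^{\vee}=\{b_1\vee\dots\vee b_n: n\in\mathbb N,\ b_i\in B\}$. An Archimedean locally solid $\ell$-ring $X$ has the $AM$-property if $B^{\vee}$ is bounded for every bounded $B\subseteq X$. A locally solid $\ell$-ring $X$ has the Levi property if every bounded upward directed set in $X_+$ has a supremum. Standing assumption: in every topological group considered (including the additive groups of topological rings), singletons are bounded in the group sense: for each $x$ and each neighborhood $U$ of the identity there is a positive integer $n$ with $x\in nU=\{x_1+\dots+x_n: x_i\in U\}$. *)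

theory Defs
  imports Complex_Main "HOL-Library.Lattice_Algebras" "HOL-Library.Set_Algebras" "HOL-Library.Lub_Glb"
begin

definition (in lattice_ab_group_add_abs) solid :: "'a set \<Rightarrow> bool" where
  "solid S \<longleftrightarrow> (\<forall>x y. y \<in> S \<longrightarrow> \<bar>x\<bar> \<le> \<bar>y\<bar> \<longrightarrow> x \<in> S)"

definition (in topological_ab_group_add) zero_nhd :: "'a set \<Rightarrow> bool" where
  "zero_nhd W \<longleftrightarrow> (\<forall>\<^sub>F x in nhds 0. x \<in> W)"

text \<open>
  \<^class>\<open>lattice_ring\<close> postulates compatibility of order and product in the form that multiplication
  by nonnegative elements is monotone. This is the requirement \<open>\<bar>x * y\<bar> \<le> \<bar>x\<bar> * \<bar>y\<bar>\<close> on an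
  \<open>\<ell>\<close>-ring: one direction is \<open>abs_le_mult\<close>; conversely, for \<open>x, y \<ge> 0\<close> it gives
  \<open>0 \<le> \<bar>x * y\<bar> \<le> x * y\<close>. No separation axiom is imposed on the topology.
\<close>

class locally_solid_lattice_ring =
  lattice_ring + topological_ab_group_add + topological_semigroup_mult +
  assumes ex_solid_zero_nhd: "zero_nhd U \<Longrightarrow> \<exists>V. zero_nhd V \<and> solid V \<and> V \<subseteq> U"

definition order_complete :: "'a::lattice itself \<Rightarrow> bool" where
  "order_complete (_ :: 'a itself) \<longleftrightarrow>
     (\<forall>S::'a set. S \<noteq> {} \<longrightarrow> bdd_above S \<longrightarrow> (\<exists>s. isLub UNIV S s))"

text \<open>The multiple \<open>n x\<close> is written as a constant sum, since \<open>of_nat\<close> would require \<open>0 \<noteq> 1\<close>.\<close>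

definition archimedean :: "'a::lattice_ab_group_add itself \<Rightarrow> bool" where
  "archimedean (_ :: 'a itself) \<longleftrightarrow>
     (\<forall>x y::'a. (\<forall>n\<ge>1. (\<Sum>i<n::nat. x) \<le> y) \<longrightarrow> x \<le> 0)"

definition singletons_group_bounded ::
    "'a::topological_ab_group_add itself \<Rightarrow> bool" where
  "singletons_group_bounded (_ :: 'a itself) \<longleftrightarrow>
     (\<forall>(x::'a) U. zero_nhd U \<longrightarrow>
        (\<exists>n\<ge>1. \<exists>f. (\<forall>i<n::nat. f i \<in> U) \<and> x = (\<Sum>i<n. f i)))"

definition ring_bounded :: "'a::{topological_ab_group_add, ring} set \<Rightarrow> bool" where
  "ring_bounded B \<longleftrightarrow>
     (\<forall>W. zero_nhd W \<longrightarrow> (\<exists>V. zero_nhd V \<and> V * B \<subseteq> W \<and> B * V \<subseteq> W))"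

definition order_bounded :: "'a::order set \<Rightarrow> bool" where
  "order_bounded B \<longleftrightarrow> (\<exists>u v. B \<subseteq> {u..v})"

definition finite_sups :: "'a::lattice set \<Rightarrow> 'a set" where
  "finite_sups B = {Sup_fin F | F. finite F \<and> F \<noteq> {} \<and> F \<subseteq> B}"

definition AM_property :: "'a::locally_solid_lattice_ring itself \<Rightarrow> bool" where
  "AM_property (_ :: 'a itself) \<longleftrightarrow>
     archimedean TYPE('a) \<and> (\<forall>B::'a set. ring_bounded B \<longrightarrow> ring_bounded (finite_sups B))"

definition upward_directed :: "'a::order set \<Rightarrow> bool" where
  "upward_directed D \<longleftrightarrow> D \<noteq> {} \<and> (\<forall>x\<in>D. \<forall>y\<in>D. \<exists>z\<in>D. x \<le> z \<and> y \<le> z)"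

definition Levi_property :: "'a::locally_solid_lattice_ring itself \<Rightarrow> bool" where
  "Levi_property (_ :: 'a itself) \<longleftrightarrow>
     (\<forall>D::'a set. D \<subseteq> {0..} \<longrightarrow> ring_bounded D \<longrightarrow> upward_directed D \<longrightarrow> (\<exists>s. isLub UNIV D s))"

end

theory Submission
  imports Defs
begin

text \<open>
  Order boundedness always implies boundedness, because a single element already controls its whole
  order interval: if \<open>\<bar>b\<bar> \<le> w\<close>, then \<open>\<bar>x * b\<bar> \<le> \<bar>x\<bar> * w\<close>, so for solid neighborhoods the smallness of
  \<open>x * b\<close> follows from continuity of multiplication by the one element \<open>w\<close>
  (\<open>order_bounded_imp_ring_bounded\<close>).

  The converse is what the \<open>AM\<close>-property and the Levi property express. Adding \<open>0\<close> to a bounded set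
  and closing it under finite suprema gives an upward directed set, which is still bounded by the
  \<open>AM\<close>-property; the Levi property supplies its supremum, hence an upper bound
  (\<open>bdd_above_if_AM_Levi\<close>). The same argument for the set of negatives gives a lower bound.

  If, conversely, the two notions of boundedness coincide, then the \<open>AM\<close>-property holds because order
  intervals are closed under finite suprema, and the Levi property becomes an instance of order
  completeness, which also forces the Archimedean property.
\<close>

text \<open>If \<open>s\<close> is the supremum of the multiples of \<open>x\<close>, then \<open>s - x\<close> is an upper bound of them as well, since
  adding \<open>x\<close> to a multiple gives another one.\<close>

lemma order_complete_imp_archimedean:
  assumes "order_complete TYPE('a::lattice_ab_group_add)"
  shows "archimedean TYPE('a)"
  unfolding archimedean_def
proof (intro allI impI)
  fix x y :: 'a
  assume le: "\<forall>n\<ge>1. (\<Sum>i<n::nat. x) \<le> y"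
  define S where "S = (\<lambda>n::nat. \<Sum>i<n. x) ` {1..}"
  have "S \<noteq> {}" "bdd_above S"
    using le by (auto simp: S_def bdd_above_def)
  then obtain s where s: "isLub UNIV S s"
    using assms unfolding order_complete_def by blast
  have "(\<Sum>i<n. x) \<le> s - x" if "n \<ge> 1" for n :: nat
  proof -
    have "(\<Sum>i<Suc n. x) \<in> S"
      unfolding S_def by (rule imageI) simp
    then have "(\<Sum>i<Suc n. x) \<le> s"
      using isLubD2[OF s] by blast
    then show ?thesis
      by (simp add: algebra_simps)
  qed
  then have "isUb UNIV S (s - x)"
    by (auto simp: S_def intro!: isUbI setleI)
  then have "s \<le> s - x"
    by (rule isLub_le_isUb[OF s])
  then show "x \<le> 0"
    by simp
qed

lemma ring_bounded_subset:
  assumes "ring_bounded B" "A \<subseteq> B"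
  shows "ring_bounded A"
proof -
  have "V * A \<subseteq> V * B" "A * V \<subseteq> B * V" for V
    using assms(2) by (simp_all add: set_times_mono2)
  then show ?thesis
    using assms(1) unfolding ring_bounded_def by (meson subset_trans)
qed

lemma ring_bounded_insert_zero:
  assumes "ring_bounded B"
  shows "ring_bounded (insert 0 B)"
  unfolding ring_bounded_def
proof (intro allI impI)
  fix W :: "'a set"
  assume W: "zero_nhd W"
  then have "0 \<in> W"
    unfolding zero_nhd_def by (rule eventually_nhds_x_imp_x)
  moreover obtain V where "zero_nhd V" "V * B \<subseteq> W" "B * V \<subseteq> W"
    using assms W unfolding ring_bounded_def by blast
  ultimately have "zero_nhd V \<and> V * insert 0 B \<subseteq> W \<and> insert 0 B * V \<subseteq> W"
    by (fastforce simp: set_times_def)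
  then show "\<exists>V. zero_nhd V \<and> V * insert 0 B \<subseteq> W \<and> insert 0 B * V \<subseteq> W"
    by blast
qed

text \<open>Solid neighborhoods are symmetric.\<close>

lemma ring_bounded_uminus:
  fixes B :: "'a::locally_solid_lattice_ring set"
  assumes "ring_bounded B"
  shows "ring_bounded (uminus ` B)"
  unfolding ring_bounded_def
proof (intro allI impI)
  fix W :: "'a set"
  assume "zero_nhd W"
  then obtain U where U: "zero_nhd U" "solid U" "U \<subseteq> W"
    using ex_solid_zero_nhd by blast
  have sym: "- x \<in> W" if "x \<in> U" for x
    using U that unfolding solid_def by (metis abs_minus_cancel order_refl subsetD)
  obtain V where "zero_nhd V" "V * B \<subseteq> U" "B * V \<subseteq> U"
    using assms U unfolding ring_bounded_def by blast
  then have "zero_nhd V \<and> V * uminus ` B \<subseteq> W \<and> uminus ` B * V \<subseteq> W"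
    by (fastforce simp: set_times_def intro: sym)
  then show "\<exists>V. zero_nhd V \<and> V * uminus ` B \<subseteq> W \<and> uminus ` B * V \<subseteq> W"
    by blast
qed

lemma order_bounded_imp_ring_bounded:
  fixes B :: "'a::locally_solid_lattice_ring set"
  assumes "order_bounded B"
  shows "ring_bounded B"
  unfolding ring_bounded_def
proof (intro allI impI)
  fix W :: "'a set"
  assume "zero_nhd W"
  then obtain U where U: "zero_nhd U" "solid U" "U \<subseteq> W"
    using ex_solid_zero_nhd by blast
  obtain u v where uv: "B \<subseteq> {u..v}"
    using assms unfolding order_bounded_def by blast
  define w where "w = \<bar>u\<bar> + \<bar>v\<bar>"
  have w: "\<bar>b\<bar> \<le> w" if "b \<in> B" for b
  proof (rule abs_leI)
    have b: "u \<le> b" "b \<le> v"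
      using uv that by auto
    show "b \<le> w"
      using b(2) abs_ge_self[of v] abs_ge_zero[of u] unfolding w_def
      by (metis add_increasing order_trans)
    show "- b \<le> w"
      using b(1) abs_ge_minus_self[of u] abs_ge_zero[of v] unfolding w_def
      by (metis add_increasing2 neg_le_iff_le order_trans)
  qed
  have "((\<lambda>x. x * w) \<longlongrightarrow> 0 * w) (nhds 0)" "((\<lambda>x. w * x) \<longlongrightarrow> w * 0) (nhds 0)"
    by (intro tendsto_mult tendsto_const filterlim_ident)+
  then have "\<forall>\<^sub>F x in nhds 0. x * w \<in> U" "\<forall>\<^sub>F x in nhds 0. w * x \<in> U"
    using U(1) unfolding zero_nhd_def filterlim_iff mult_zero_left mult_zero_right by blast+
  then have "zero_nhd {x. x * w \<in> U \<and> w * x \<in> U}"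
    by (simp add: zero_nhd_def eventually_conj)
  then obtain V where V: "zero_nhd V" "solid V" "V \<subseteq> {x. x * w \<in> U \<and> w * x \<in> U}"
    using ex_solid_zero_nhd by blast
  have "x * b \<in> W \<and> b * x \<in> W" if "x \<in> V" "b \<in> B" for x b
  proof -
    \<comment> \<open>Solidity allows replacing \<open>x\<close> by \<open>\<bar>x\<bar>\<close> before comparing products.\<close>
    have "\<bar>x\<bar> \<in> V"
      using V(2) that(1) unfolding solid_def by (metis abs_idempotent order_refl)
    then have U': "\<bar>x\<bar> * w \<in> U" "w * \<bar>x\<bar> \<in> U"
      using V(3) by auto
    have "\<bar>x * b\<bar> \<le> \<bar>x\<bar> * w"
      using abs_le_mult[of x b] mult_left_mono[OF w[OF that(2)] abs_ge_zero[of x]]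
      by (rule order_trans)
    moreover have "\<bar>b * x\<bar> \<le> w * \<bar>x\<bar>"
      using abs_le_mult[of b x] mult_right_mono[OF w[OF that(2)] abs_ge_zero[of x]]
      by (rule order_trans)
    ultimately have "\<bar>x * b\<bar> \<le> \<bar>\<bar>x\<bar> * w\<bar>" "\<bar>b * x\<bar> \<le> \<bar>w * \<bar>x\<bar>\<bar>"
      by (meson abs_ge_self order_trans)+
    then show ?thesis
      using U(2,3) U' unfolding solid_def by blast
  qed
  then have "zero_nhd V \<and> V * B \<subseteq> W \<and> B * V \<subseteq> W"
    using V(1) by (auto simp: set_times_def)
  then show "\<exists>V. zero_nhd V \<and> V * B \<subseteq> W \<and> B * V \<subseteq> W"
    by blast
qed

lemma sup_in_finite_sups:
  assumes "x \<in> finite_sups B" "y \<in> finite_sups B"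
  shows "sup x y \<in> finite_sups B"
proof -
  obtain F G where F: "finite F" "F \<noteq> {}" "F \<subseteq> B" "x = Sup_fin F"
    and G: "finite G" "G \<noteq> {}" "G \<subseteq> B" "y = Sup_fin G"
    using assms unfolding finite_sups_def by blast
  have "sup x y = Sup_fin (F \<union> G)"
    using F G by (simp add: Sup_fin.union)
  then show ?thesis
    using F G unfolding finite_sups_def by blast
qed

lemma subset_finite_sups: "B \<subseteq> finite_sups B"
proof
  fix b assume "b \<in> B"
  then show "b \<in> finite_sups B"
    unfolding finite_sups_def by (auto intro!: exI[of _ "{b}"])
qed

lemma bdd_above_if_AM_Levi:
  fixes B :: "'a::locally_solid_lattice_ring set"
  assumes "AM_property TYPE('a)" "Levi_property TYPE('a)" "ring_bounded B"
  obtains s where "\<And>b. b \<in> B \<Longrightarrow> b \<le> s"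
proof -
  \<comment> \<open>The Levi property concerns positive elements only; since \<open>0\<close> has been added to \<open>B\<close>, the
    positive finite suprema are still cofinal among all of them.\<close>
  define D where "D = finite_sups (insert 0 B) \<inter> {0..}"
  have mem: "sup b 0 \<in> D" if "b \<in> insert 0 B" for b
    using that subset_finite_sups[of "insert 0 B"]
    by (auto simp: D_def intro!: sup_in_finite_sups)
  have "ring_bounded D"
    using assms(1) ring_bounded_insert_zero[OF assms(3)] unfolding AM_property_def D_def
    by (blast intro: ring_bounded_subset)
  moreover have "upward_directed D"
    unfolding upward_directed_def
  proof (intro conjI ballI)
    show "D \<noteq> {}"
      using mem by blast
    fix x y assume "x \<in> D" "y \<in> D"
    then have "sup x y \<in> D"
      by (auto simp: D_def intro: sup_in_finite_sups le_supI1)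
    then show "\<exists>z\<in>D. x \<le> z \<and> y \<le> z"
      by (metis sup_ge1 sup_ge2)
  qed
  moreover have "D \<subseteq> {0..}"
    by (simp add: D_def)
  ultimately obtain s where s: "isLub UNIV D s"
    using assms(2) unfolding Levi_property_def by blast
  have "b \<le> s" if "b \<in> B" for b
    using isLubD2[OF s mem[of b]] that by simp
  then show thesis
    by (rule that)
qed

lemma ring_bounded_imp_order_bounded_if_AM_Levi:
  fixes B :: "'a::locally_solid_lattice_ring set"
  assumes "AM_property TYPE('a)" "Levi_property TYPE('a)" "ring_bounded B"
  shows "order_bounded B"
proof -
  obtain s where s: "\<And>b. b \<in> B \<Longrightarrow> b \<le> s"
    using bdd_above_if_AM_Levi[OF assms] by blast
  obtain t where t: "\<And>b. b \<in> uminus ` B \<Longrightarrow> b \<le> t"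
    using bdd_above_if_AM_Levi[OF assms(1,2) ring_bounded_uminus[OF assms(3)]] by blast
  have "B \<subseteq> {- t..s}"
    using s t by (auto simp: minus_le_iff)
  then show ?thesis
    unfolding order_bounded_def by blast
qed

lemma order_bounded_finite_sups:
  assumes "order_bounded B"
  shows "order_bounded (finite_sups B)"
proof -
  obtain u v where uv: "B \<subseteq> {u..v}"
    using assms unfolding order_bounded_def by blast
  have "Sup_fin F \<in> {u..v}" if "finite F" "F \<noteq> {}" "F \<subseteq> B" for F
  proof -
    obtain a where "a \<in> F"
      using \<open>F \<noteq> {}\<close> by blast
    then have "u \<le> a" "a \<le> Sup_fin F"
      using that uv by (auto intro: Sup_fin.coboundedI)
    moreover have "Sup_fin F \<le> v"
      using that uv by (intro Sup_fin.boundedI) auto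
    ultimately show ?thesis
      by auto
  qed
  then have "finite_sups B \<subseteq> {u..v}"
    unfolding finite_sups_def by blast
  then show ?thesis
    unfolding order_bounded_def by blast
qed

lemma AM_property_if_ring_bounded_imp_order_bounded:
  assumes "order_complete TYPE('a::locally_solid_lattice_ring)"
    and "\<And>B::'a set. ring_bounded B \<Longrightarrow> order_bounded B"
  shows "AM_property TYPE('a)"
  unfolding AM_property_def
  using assms(2) order_complete_imp_archimedean[OF assms(1)]
    order_bounded_finite_sups order_bounded_imp_ring_bounded by blast

lemma Levi_property_if_ring_bounded_imp_order_bounded:
  assumes "order_complete TYPE('a::locally_solid_lattice_ring)"
    and "\<And>B::'a set. ring_bounded B \<Longrightarrow> order_bounded B"
  shows "Levi_property TYPE('a)"
  unfolding Levi_property_def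
proof (intro allI impI)
  fix D :: "'a set"
  assume "ring_bounded D" "upward_directed D"
  then have "D \<noteq> {}" "order_bounded D"
    using assms(2) by (auto simp: upward_directed_def)
  then have "D \<noteq> {}" "bdd_above D"
    by (auto simp: order_bounded_def intro: bdd_above_mono)
  then show "\<exists>s. isLub UNIV D s"
    using assms(1) unfolding order_complete_def by blast
qed

theorem corollary2:
  assumes "singletons_group_bounded TYPE('a::{locally_solid_lattice_ring, monoid_mult})"
    and "order_complete TYPE('a)"
  shows "AM_property TYPE('a) \<and> Levi_property TYPE('a) \<longleftrightarrow>
    (\<forall>B::'a set. order_bounded B \<longrightarrow> ring_bounded B) \<and>
    (\<forall>B::'a set. ring_bounded B \<longrightarrow> order_bounded B)"
  using order_bounded_imp_ring_bounded ring_bounded_imp_order_bounded_if_AM_Levi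
    AM_property_if_ring_bounded_imp_order_bounded[OF assms(2)]
    Levi_property_if_ring_bounded_imp_order_bounded[OF assms(2)]
  by blast

end
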